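(* Let $n\ge2$ and $F(\kappa)=p_2^{1/2}(\kappa)$. There is a constant $C>0$, independent of $\kappa$, such that for every $\kappa=(\kappa_1,\dots,\kappa_n)$ with all $\kappa_i>0$, $$\frac1C\left(\sum_{i=1}^n\frac{\partial F}{\partial\kappa_i}-1\right)\ \le\ \frac{1}{F^2}\sum_{i=1}^n\frac{\partial F}{\partial\kappa_i}\kappa_i^2-1\ \le\ C\left(\sum_{i=1}^n\frac{\partial F}{\partial\kappa_i}-1\right).$$
   Context: $p_2(\kappa)=\binom n2^{-1}\sum_{i<j}\kappa_i\kappa_j$ is the normalized second elementary symmetric function. *)

theory Defs
  imports "HOL-Analysis.Analysis"
begin

(* The index type is a finite linear order, standing for {1..n} with n = CARD('n). *)
definition p2 :: "real ^ 'n::{finite,linorder} \<Rightarrow> real" where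
  "p2 \<kappa> = (\<Sum>(i, j) \<in> {(i, j). i < j}. \<kappa> $ i * \<kappa> $ j) / real (CARD('n) choose 2)"

definition F :: "real ^ 'n::{finite,linorder} \<Rightarrow> real" where
  "F \<kappa> = sqrt (p2 \<kappa>)"

definition partial_deriv :: "(real ^ 'n::finite \<Rightarrow> real) \<Rightarrow> 'n \<Rightarrow> real ^ 'n \<Rightarrow> real" where
  "partial_deriv f i x = deriv (\<lambda>t. f (x + t *\<^sub>R axis i 1)) 0"

end

theory Submission
  imports Defs
begin

text \<open>
  Let \<open>m\<close> be the mean of \<open>\<kappa>\<close>, let \<open>x\<^sub>i = \<kappa>\<^sub>i - m\<close>, and put \<open>q\<^sup>2 = m\<^sup>2 - F\<^sup>2\<close>. Then
  \<open>\<Sum>x\<^sub>i\<^sup>2 = n(n-1)q\<^sup>2\<close>, the sum of the partial derivatives is \<open>m/F\<close>, and \<open>F \<Sum>(\<partial>F/\<partial>\<kappa>\<^sub>i) \<kappa>\<^sub>i\<^sup>2\<close>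
  equals \<open>T = m\<^sup>3 + (n-3) m q\<^sup>2 - \<Sum>x\<^sub>i\<^sup>3 / (n(n-1))\<close>. So \<open>T - F\<^sup>3\<close> has to be compared
  with \<open>F\<^sup>2 (m - F)\<close>. The lower bound, with constant 1, comes from the sharp skewness estimate
  \<open>\<Sum>x\<^sub>i\<^sup>3 \<le> n(n-1)(n-2)q\<^sup>3\<close> and \<open>q \<le> m\<close>. The upper bound uses \<open>x\<^sub>i \<ge> -m\<close> if \<open>m \<le> 2F\<close> and
  the crude estimate \<open>T \<le> n m F\<^sup>2\<close> otherwise.
\<close>

section \<open>\<open>p2\<close> and the partial derivatives of \<open>F\<close> through power
  sums\<close>

lemma sum_off_diagonal:
  fixes f :: "'n::{finite,linorder} \<Rightarrow> real"
  shows "2 * (\<Sum>(i, j) \<in> {(i, j). i < j}. f i * f j) = (\<Sum>i\<in>UNIV. f i)\<^sup>2 - (\<Sum>i\<in>UNIV. (f i)\<^sup>2)"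
proof -
  let ?g = "\<lambda>(i, j). f i * f j"
  let ?L = "{(i, j). i < j} :: ('n \<times> 'n) set"
  let ?U = "{(i, j). j < i} :: ('n \<times> 'n) set"
  let ?D = "(\<lambda>i. (i, i)) ` (UNIV :: 'n set)"
  have "(\<Sum>i\<in>UNIV. f i)\<^sup>2 = sum ?g (UNIV \<times> UNIV)"
    by (simp add: power2_eq_square sum_product sum.cartesian_product)
  also have "UNIV \<times> UNIV = (?L \<union> ?U) \<union> ?D"
    by auto
  also have "sum ?g \<dots> = sum ?g (?L \<union> ?U) + sum ?g ?D"
    by (rule sum.union_disjoint) auto
  also have "sum ?g (?L \<union> ?U) = sum ?g ?L + sum ?g ?U"
    by (rule sum.union_disjoint) auto
  also have "sum ?g ?U = sum ?g ?L"
    by (rule sum.reindex_bij_witness[of _ prod.swap prod.swap]) (auto simp: mult.commute)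
  also have "sum ?g ?D = (\<Sum>i\<in>UNIV. (f i)\<^sup>2)"
    by (subst sum.reindex) (auto simp: inj_on_def power2_eq_square)
  finally show ?thesis by simp
qed

lemma real_choose_two: "real (n choose 2) = real n * (real n - 1) / 2"
  using binomial_gbinomial[of n 2, where ?'a = real]
  by (simp add: gbinomial_prod_rev numeral_2_eq_2)

lemma p2_eq:
  "p2 (\<kappa> :: real ^ 'n::{finite,linorder}) =
     ((\<Sum>i\<in>UNIV. \<kappa> $ i)\<^sup>2 - (\<Sum>i\<in>UNIV. (\<kappa> $ i)\<^sup>2)) / (real CARD('n) * (real CARD('n) - 1))"
  unfolding p2_def sum_off_diagonal[symmetric] real_choose_two by simp

lemma p2_pos:
  fixes \<kappa> :: "real ^ 'n::{finite,linorder}"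
  assumes n: "CARD('n) \<ge> 2" and pos: "\<And>i. \<kappa> $ i > 0"
  shows "p2 \<kappa> > 0"
proof -
  obtain a b :: 'n where "a < b"
  proof -
    have "\<not> CARD('n) \<le> Suc 0" using n by simp
    then obtain a b :: 'n where "a \<noteq> b"
      by (auto simp: card_le_Suc0_iff_eq)
    then show thesis using that by (metis neqE)
  qed
  then have "(\<Sum>(i, j) \<in> {(i, j). i < j}. \<kappa> $ i * \<kappa> $ j) > 0"
    by (intro sum_pos2[where i = "(a, b)"]) (auto simp: pos less_imp_le)
  then show ?thesis
    unfolding p2_def using n by (intro divide_pos_pos) (auto simp: zero_less_binomial)
qed

text \<open>This is \<open>F\<close> along a coordinate axis: raising a coordinate \<open>a\<close>
  by \<open>t\<close> adds \<open>t\<close> to the sum \<open>S\<close> and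
  \<open>2 * t * a + t^2\<close> to the sum of squares \<open>Q\<close>.\<close>

lemma DERIV_sqrt_quadratic:
  fixes S Q a K :: real
  assumes "(S\<^sup>2 - Q) / K > 0"
  shows "((\<lambda>t. sqrt (((S + t)\<^sup>2 - (Q + (2 * t * a + t\<^sup>2))) / K)) has_real_derivative
    (S - a) / (K * sqrt ((S\<^sup>2 - Q) / K))) (at 0)"
proof -
  have "((\<lambda>t. (S + t)\<^sup>2 - (Q + (2 * t * a + t\<^sup>2))) has_real_derivative 2 * (S - a)) (at 0)"
    by (auto intro!: derivative_eq_intros)
  then have "((\<lambda>t. ((S + t)\<^sup>2 - (Q + (2 * t * a + t\<^sup>2))) / K) has_real_derivative
      2 * (S - a) / K) (at 0)"
    by (rule DERIV_cdivide)
  from DERIV_chain2[OF DERIV_real_sqrt this] assms show ?thesis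
    by (simp add: inverse_eq_divide mult.commute del: right_diff_distrib_numeral left_diff_distrib_numeral)
qed

lemma partial_deriv_F:
  fixes \<kappa> :: "real ^ 'n::{finite,linorder}"
  assumes "p2 \<kappa> > 0"
  shows "partial_deriv F k \<kappa> =
    ((\<Sum>i\<in>UNIV. \<kappa> $ i) - \<kappa> $ k) / (real CARD('n) * (real CARD('n) - 1) * F \<kappa>)"
proof -
  let ?S = "\<Sum>i\<in>UNIV. \<kappa> $ i" and ?Q = "\<Sum>i\<in>UNIV. (\<kappa> $ i)\<^sup>2"
  let ?K = "real CARD('n) * (real CARD('n) - 1)"
  have comp: "(\<kappa> + t *\<^sub>R axis k 1) $ i = \<kappa> $ i + (if i = k then t else 0)" for t i
    by (simp add: axis_def)
  have S: "(\<Sum>i\<in>UNIV. (\<kappa> + t *\<^sub>R axis k 1) $ i) = ?S + t" for t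
    unfolding comp by (simp add: sum.distrib)
  have "(\<Sum>i\<in>UNIV. ((\<kappa> + t *\<^sub>R axis k 1) $ i)\<^sup>2)
      = (\<Sum>i\<in>UNIV. (\<kappa> $ i)\<^sup>2 + (if i = k then 2 * t * \<kappa> $ k + t\<^sup>2 else 0))" for t
    unfolding comp by (intro sum.cong) (auto simp: power2_sum)
  then have Q: "(\<Sum>i\<in>UNIV. ((\<kappa> + t *\<^sub>R axis k 1) $ i)\<^sup>2) = ?Q + (2 * t * \<kappa> $ k + t\<^sup>2)" for t
    by (simp add: sum.distrib)
  have F_line: "F (\<kappa> + t *\<^sub>R axis k 1)
      = sqrt (((?S + t)\<^sup>2 - (?Q + (2 * t * \<kappa> $ k + t\<^sup>2))) / ?K)" for t
    unfolding F_def p2_eq S Q ..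
  have pos: "(?S\<^sup>2 - ?Q) / ?K > 0"
    using assms unfolding p2_eq .
  have "partial_deriv F k \<kappa> = (?S - \<kappa> $ k) / (?K * sqrt ((?S\<^sup>2 - ?Q) / ?K))"
    unfolding partial_deriv_def F_line using pos
    by (intro DERIV_imp_deriv DERIV_sqrt_quadratic)
  then show ?thesis
    unfolding F_def p2_eq .
qed

section \<open>Moment inequalities for families with zero sum\<close>

text \<open>\<open>x k\<close> is minus the sum of the other entries, so Cauchy-Schwarz over those
  bounds its square; collecting the \<open>x k\<close> terms gives the factor
  \<open>card A\<close>.\<close>

lemma centered_component_bound:
  fixes x :: "'a \<Rightarrow> real"
  assumes "finite A" "k \<in> A" "(\<Sum>i\<in>A. x i) = 0"
  shows "real (card A) * (x k)\<^sup>2 \<le> (real (card A) - 1) * (\<Sum>i\<in>A. (x i)\<^sup>2)"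
proof -
  have "(x k)\<^sup>2 = (\<Sum>i\<in>A - {k}. x i)\<^sup>2"
    using assms by (simp add: sum_diff1)
  also have "\<dots> \<le> real (card (A - {k})) * (\<Sum>i\<in>A - {k}. (x i)\<^sup>2)"
    using sum_squared_le_sum_of_squares[of x "A - {k}"] assms by (simp add: mult.commute)
  also have "real (card (A - {k})) = real (card A) - 1"
    using card_Suc_Diff1[OF assms(1,2)] by linarith
  finally show ?thesis
    using assms by (simp add: sum_diff1 algebra_simps)
qed

text \<open>The component bound gives \<open>x i <= (n - 1) * q\<close>, so the cubic
  \<open>(x + q)^2 * (x - (n - 1) * q)\<close> is nonpositive at every entry. In the sum of its
  expansion the linear term drops out and the quadratic one is prescribed.\<close>

lemma centered_cubes_bound:
  fixes x :: "'a \<Rightarrow> real"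
  assumes A: "finite A" and sum0: "(\<Sum>i\<in>A. x i) = 0" and q: "q \<ge> 0"
    and n: "n = real (card A)" "n \<ge> 1"
    and sq: "(\<Sum>i\<in>A. (x i)\<^sup>2) = n * (n - 1) * q\<^sup>2"
  shows "(\<Sum>i\<in>A. x i ^ 3) \<le> n * (n - 1) * (n - 2) * q ^ 3"
proof -
  have le: "x i \<le> (n - 1) * q" if "i \<in> A" for i
  proof (rule power2_le_imp_le)
    have "n * (x i)\<^sup>2 \<le> n * ((n - 1) * q)\<^sup>2"
      using centered_component_bound[OF A that sum0] unfolding n(1)[symmetric] sq
      by (simp add: power2_eq_square mult_ac)
    then show "(x i)\<^sup>2 \<le> ((n - 1) * q)\<^sup>2"
      using n by simp
  qed (use n q in simp)
  \<comment> \<open>This vanishes termwise at the extremal configuration: one \<open>x\<^sub>i\<close> equal to \<open>(n-1)q\<close>, the others \<open>-q\<close>.\<close>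
  have "(\<Sum>i\<in>A. (x i + q)\<^sup>2 * (x i - (n - 1) * q)) \<le> 0"
    by (intro sum_nonpos mult_nonneg_nonpos) (use le in auto)
  moreover have "(x i + q)\<^sup>2 * (x i - (n - 1) * q) =
      x i ^ 3 - (n - 3) * q * (x i)\<^sup>2 - (2 * n - 3) * q\<^sup>2 * x i - (n - 1) * q ^ 3" for i
    by (simp add: power2_eq_square power3_eq_cube algebra_simps)
  ultimately have "(\<Sum>i\<in>A. x i ^ 3) \<le> (n - 3) * q * (n * (n - 1) * q\<^sup>2) + (n - 1) * (n * q ^ 3)"
    by (simp only: sum_subtractf sum_distrib_left[symmetric] sum_constant sum0 sq n(1)[symmetric])
  also have "\<dots> = n * (n - 1) * (n - 2) * q ^ 3"
    by (simp add: power2_eq_square power3_eq_cube algebra_simps)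
  finally show ?thesis .
qed

section \<open>The inequality between scalars\<close>

text \<open>Both sides of the theorem are scaled by \<open>f ^ 3\<close> here, and \<open>Y\<close>
  is the normalized third central moment. For \<open>m <= 2 * f\<close> a factor
  \<open>m - f\<close> has to be extracted from \<open>T - f ^ 3\<close>; for larger
  \<open>m\<close> the difference \<open>m - f\<close> is itself comparable to
  \<open>m\<close>.\<close>

lemma scalar_comparison:
  fixes n m q f T Y :: real
  assumes "n \<ge> 2" "m > 0" "f > 0" "q \<ge> 0" and m: "m\<^sup>2 = f\<^sup>2 + q\<^sup>2"
    and T: "T = m ^ 3 + (n - 3) * m * q\<^sup>2 - Y"
    and Y: "Y \<le> (n - 2) * q ^ 3" "Y \<ge> - (m * q\<^sup>2)"
    and crude: "T \<le> n * m * f\<^sup>2"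
  shows "f\<^sup>2 * (m - f) \<le> T - f ^ 3" and "T - f ^ 3 \<le> 6 * n * (f\<^sup>2 * (m - f))"
proof -
  have qm: "q \<le> m"
    by (rule power2_le_imp_le) (use m \<open>m > 0\<close> in auto)
  have fm: "f \<le> m"
    by (rule power2_le_imp_le) (use m \<open>m > 0\<close> in auto)
  have "q ^ 3 \<le> m * q\<^sup>2"
    using mult_right_mono[OF qm, of "q\<^sup>2"] by (simp add: power3_eq_cube power2_eq_square mult_ac)
  then have "(n - 2) * q ^ 3 \<le> (n - 2) * (m * q\<^sup>2)"
    using \<open>n \<ge> 2\<close> by (intro mult_left_mono) auto
  \<comment> \<open>The coefficients of \<open>m * q^2\<close> combine to
    \<open>(n - 3) - (n - 2) = -1\<close>, whatever \<open>n\<close> is.\<close>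
  then have "T \<ge> m ^ 3 - m * q\<^sup>2"
    using Y(1) unfolding T by (simp add: algebra_simps)
  also have "m ^ 3 - m * q\<^sup>2 = m * (m\<^sup>2 - q\<^sup>2)"
    by (simp add: power3_eq_cube power2_eq_square algebra_simps)
  also have "\<dots> = m * f\<^sup>2" using m by simp
  finally show "f\<^sup>2 * (m - f) \<le> T - f ^ 3"
    by (simp add: power3_eq_cube power2_eq_square algebra_simps)
  show "T - f ^ 3 \<le> 6 * n * (f\<^sup>2 * (m - f))"
  proof (cases "m \<le> 2 * f")
    case True
    have mf: "m * f \<le> 2 * f\<^sup>2"
      using mult_right_mono[OF True, of f] \<open>f > 0\<close> by (simp add: power2_eq_square)
    have "m * m \<le> m * (2 * f)"
      using True \<open>m > 0\<close> by (intro mult_left_mono) auto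
    with mf have mm: "m * m \<le> 4 * f\<^sup>2" by linarith
    have "T - f ^ 3 \<le> m ^ 3 - f ^ 3 + (n - 2) * m * q\<^sup>2"
      using Y(2) unfolding T by (simp add: algebra_simps)
    also have "q\<^sup>2 = (m - f) * (m + f)"
      using m by (simp add: power2_eq_square algebra_simps)
    also have "m ^ 3 - f ^ 3 + (n - 2) * m * ((m - f) * (m + f)) =
        (m - f) * (m * m + m * f + f\<^sup>2 + (n - 2) * (m * m + m * f))"
      by (simp add: power3_eq_cube power2_eq_square algebra_simps)
    \<comment> \<open>Bounds \<open>m * m\<close> by \<open>4 * f^2\<close> and \<open>m * f\<close>
      by \<open>2 * f^2\<close>: hence 4 + 2 + 1 = 7 and 4 + 2 = 6.\<close>
    also have "\<dots> \<le> (m - f) * (7 * f\<^sup>2 + (n - 2) * (6 * f\<^sup>2))"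
      by (intro mult_left_mono add_mono) (use mm mf fm \<open>n \<ge> 2\<close> in auto)
    also have "\<dots> = (6 * n - 5) * (f\<^sup>2 * (m - f))"
      by (simp add: algebra_simps)
    also have "\<dots> \<le> 6 * n * (f\<^sup>2 * (m - f))"
      by (intro mult_right_mono) (use fm in auto)
    finally show ?thesis .
  next
    case False
    have "T - f ^ 3 \<le> n * m * f\<^sup>2"
      using crude \<open>f > 0\<close> zero_less_power[of f 3] by linarith
    also have "\<dots> = n * f\<^sup>2 * m" by simp
    \<comment> \<open>Already \<open>m <= 2 * (m - f)\<close> holds here; the 6 matches the constant
      of the other case.\<close>
    also have "\<dots> \<le> n * f\<^sup>2 * (6 * (m - f))"
      by (intro mult_left_mono) (use False \<open>n \<ge> 2\<close> fm \<open>f > 0\<close> in auto)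
    finally show ?thesis by (simp add: algebra_simps)
  qed
qed

section \<open>Reduction of the theorem to the scalars\<close>

lemma derivative_sums_comparison:
  fixes \<kappa> :: "real ^ 'n::{finite,linorder}"
  assumes card: "CARD('n) \<ge> 2" and pos: "\<And>i. \<kappa> $ i > 0"
  defines "A \<equiv> (\<Sum>i\<in>UNIV. partial_deriv F i \<kappa>) - 1"
    and "B \<equiv> (1 / (F \<kappa>)\<^sup>2) * (\<Sum>i\<in>UNIV. partial_deriv F i \<kappa> * (\<kappa> $ i)\<^sup>2) - 1"
  shows "A \<ge> 0" "A \<le> B" "B \<le> 6 * real CARD('n) * A"
proof -
  define n where "n = real CARD('n)"
  define f where "f = F \<kappa>"
  define S where "S = (\<Sum>i\<in>UNIV. \<kappa> $ i)"
  define m where "m = S / n"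
  define x where "x i = \<kappa> $ i - m" for i
  define V where "V = (\<Sum>i\<in>UNIV. (x i)\<^sup>2)"
  define X where "X = (\<Sum>i\<in>UNIV. x i ^ 3)"
  \<comment> \<open>Dividing \<open>V\<close> by \<open>n * (n - 1)\<close> instead of
    \<open>n\<close> makes \<open>m^2 = f^2 + q^2\<close> exact.\<close>
  define K where "K = n * (n - 1)"
  define q where "q = sqrt (V / K)"
  define T where "T = (\<Sum>i\<in>UNIV. (S - \<kappa> $ i) * (\<kappa> $ i)\<^sup>2) / K"
  have n: "n \<ge> 2" using card unfolding n_def by simp
  have K: "K > 0" using n unfolding K_def by simp
  have p2: "p2 \<kappa> > 0" using p2_pos[OF card pos] .
  have f: "f > 0" using p2 unfolding f_def F_def by simp
  have S: "S > 0" unfolding S_def by (intro sum_pos) (auto intro: pos)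
  have m: "m > 0" using S n unfolding m_def by simp
  have V: "V \<ge> 0" unfolding V_def by (intro sum_nonneg) auto
  have q: "q \<ge> 0" using V K unfolding q_def by simp
  have Vq: "V = K * q\<^sup>2" using V K unfolding q_def by simp
  have Sm: "S = n * m" using n unfolding m_def by simp
  have \<kappa>: "\<kappa> $ i = m + x i" for i unfolding x_def by simp
  have sum0: "(\<Sum>i\<in>UNIV. x i) = 0"
    unfolding x_def by (simp add: sum_subtractf S_def[symmetric] n_def[symmetric] Sm)
  have Q: "(\<Sum>i\<in>UNIV. (\<kappa> $ i)\<^sup>2) = n * m\<^sup>2 + V"
    unfolding \<kappa> power2_sum
    by (simp add: sum.distrib V_def n_def sum0 flip: sum_distrib_left)
  have "f\<^sup>2 = p2 \<kappa>" using p2 unfolding f_def F_def by simp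
  also have "\<dots> = (K * m\<^sup>2 - V) / K"
    unfolding p2_eq S_def[symmetric] n_def[symmetric] Q K_def Sm
    by (simp add: power2_eq_square algebra_simps)
  also have "\<dots> = m\<^sup>2 - q\<^sup>2" using K by (simp add: Vq field_simps)
  finally have f2: "f\<^sup>2 = m\<^sup>2 - q\<^sup>2" .
  then have m2: "m\<^sup>2 = f\<^sup>2 + q\<^sup>2" by simp
  have pd: "partial_deriv F i \<kappa> = (S - \<kappa> $ i) / (K * f)" for i
    unfolding partial_deriv_F[OF p2] S_def K_def n_def f_def ..
  have "(\<Sum>i\<in>UNIV. S - \<kappa> $ i) = K * m"
    by (simp add: sum_subtractf S_def[symmetric] n_def[symmetric] K_def Sm algebra_simps)
  then have A: "A = (m - f) / f"
    unfolding A_def pd sum_divide_distrib[symmetric] using K f by (simp add: field_simps)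
  have B: "B = (T - f ^ 3) / f ^ 3"
    unfolding B_def pd times_divide_eq_left sum_divide_distrib[symmetric] T_def f_def[symmetric]
    using K f by (simp add: field_simps power2_eq_square power3_eq_cube)
  have "(S - \<kappa> $ i) * (\<kappa> $ i)\<^sup>2 =
      (n - 1) * m ^ 3 + (2 * n - 3) * m\<^sup>2 * x i + (n - 3) * m * (x i)\<^sup>2 - x i ^ 3" for i
    unfolding \<kappa> Sm by (simp add: power2_eq_square power3_eq_cube algebra_simps)
  then have "T = (K * m ^ 3 + (n - 3) * m * V - X) / K"
    unfolding T_def
    by (simp add: sum.distrib sum_subtractf sum0 V_def X_def K_def n_def
        flip: sum_distrib_left)
  then have T: "T = m ^ 3 + (n - 3) * m * q\<^sup>2 - X / K"
    using K by (simp add: Vq field_simps)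
  have "X \<le> n * (n - 1) * (n - 2) * q ^ 3"
    unfolding X_def using Vq n
    by (intro centered_cubes_bound sum0 q) (auto simp: n_def V_def K_def)
  then have Y1: "X / K \<le> (n - 2) * q ^ 3"
    using K by (simp add: divide_le_eq K_def mult_ac)
  \<comment> \<open>Positivity of the entries of \<kappa> means \<open>x i > - m\<close>; this is
    multiplied by the square of \<open>x i\<close> and summed.\<close>
  have "- (m * V) = (\<Sum>i\<in>UNIV. - m * (x i)\<^sup>2)"
    unfolding V_def by (simp add: sum_distrib_left sum_negf)
  also have "\<dots> \<le> X"
    unfolding X_def
  proof (rule sum_mono)
    fix i
    have "- m * (x i)\<^sup>2 \<le> x i * (x i)\<^sup>2"
      using pos[of i] unfolding \<kappa> by (intro mult_right_mono) auto
    then show "- m * (x i)\<^sup>2 \<le> x i ^ 3"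
      by (simp add: power2_eq_square power3_eq_cube)
  qed
  finally have Y2: "X / K \<ge> - (m * q\<^sup>2)"
    using K by (simp add: le_divide_eq Vq mult_ac)
  \<comment> \<open>Replacing one factor \<kappa>\<open>$ i\<close> by \<open>S\<close> leaves the
    sum of \<open>(S -\<close>\<kappa>\<open>$ i) *\<close>\<kappa>\<open>$ i\<close>, which is
    \<open>K * f^2\<close>.\<close>
  have "(\<Sum>i\<in>UNIV. (S - \<kappa> $ i) * (\<kappa> $ i)\<^sup>2) \<le> (\<Sum>i\<in>UNIV. S * ((S - \<kappa> $ i) * \<kappa> $ i))"
  proof (rule sum_mono)
    fix i
    have "\<kappa> $ i \<le> S"
      unfolding S_def by (rule member_le_sum) (auto intro: less_imp_le pos)
    then have "((S - \<kappa> $ i) * \<kappa> $ i) * \<kappa> $ i \<le> ((S - \<kappa> $ i) * \<kappa> $ i) * S"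
      using pos[of i] by (intro mult_left_mono) auto
    then show "(S - \<kappa> $ i) * (\<kappa> $ i)\<^sup>2 \<le> S * ((S - \<kappa> $ i) * \<kappa> $ i)"
      by (simp add: power2_eq_square mult_ac)
  qed
  also have "\<dots> = S * (S\<^sup>2 - (\<Sum>i\<in>UNIV. (\<kappa> $ i)\<^sup>2))"
    by (simp add: left_diff_distrib sum_subtractf S_def[symmetric] power2_eq_square
        flip: sum_distrib_left)
  also have "\<dots> = K * (n * m * f\<^sup>2)"
    unfolding Q Vq Sm f2 by (simp add: K_def power2_eq_square algebra_simps)
  finally have crude: "T \<le> n * m * f\<^sup>2"
    unfolding T_def using K by (simp add: divide_le_eq mult_ac)
  note comparison = scalar_comparison[OF n m f q m2 T Y1 Y2 crude]
  have A': "A = f\<^sup>2 * (m - f) / f ^ 3"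
    unfolding A using f by (simp add: field_simps power2_eq_square power3_eq_cube)
  have "f \<le> m"
    by (rule power2_le_imp_le) (use m m2 in auto)
  then show "A \<ge> 0"
    unfolding A using f by simp
  show "A \<le> B"
    unfolding A' B using comparison(1) f by (intro divide_right_mono) auto
  have "B \<le> 6 * n * (f\<^sup>2 * (m - f)) / f ^ 3"
    unfolding B using comparison(2) f by (intro divide_right_mono) auto
  then show "B \<le> 6 * real CARD('n) * A"
    unfolding A' n_def by simp
qed

theorem lemma3p7:
  assumes "CARD('n::{finite,linorder}) \<ge> 2"
  shows "\<exists>C>(0::real). \<forall>\<kappa> :: real ^ 'n::{finite,linorder}. (\<forall>i. \<kappa> $ i > 0) \<longrightarrow>
     (1 / C) * ((\<Sum>i\<in>UNIV. partial_deriv F i \<kappa>) - 1)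
       \<le> (1 / (F \<kappa>)\<^sup>2) * (\<Sum>i\<in>UNIV. partial_deriv F i \<kappa> * (\<kappa> $ i)\<^sup>2) - 1 \<and>
     (1 / (F \<kappa>)\<^sup>2) * (\<Sum>i\<in>UNIV. partial_deriv F i \<kappa> * (\<kappa> $ i)\<^sup>2) - 1
       \<le> C * ((\<Sum>i\<in>UNIV. partial_deriv F i \<kappa>) - 1)"
proof (intro exI[of _ "6 * real CARD('n)"] conjI allI impI)
  show "6 * real CARD('n) > 0" by simp
next
  fix \<kappa> :: "real ^ 'n::{finite,linorder}" assume "\<forall>i. \<kappa> $ i > 0"
  then have pos: "\<kappa> $ i > 0" for i by blast
  note bounds = derivative_sums_comparison[OF assms pos]
  \<comment> \<open>The lower bound holds with constant 1; nonnegativity of the sum of derivatives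
    minus 1 lets it be weakened to \<open>1 / C\<close>.\<close>
  have "1 / (6 * real CARD('n)) * ((\<Sum>i\<in>UNIV. partial_deriv F i \<kappa>) - 1)
      \<le> 1 * ((\<Sum>i\<in>UNIV. partial_deriv F i \<kappa>) - 1)"
    using assms bounds(1) by (intro mult_right_mono) (auto simp: divide_le_eq)
  then show "1 / (6 * real CARD('n)) * ((\<Sum>i\<in>UNIV. partial_deriv F i \<kappa>) - 1)
      \<le> (1 / (F \<kappa>)\<^sup>2) * (\<Sum>i\<in>UNIV. partial_deriv F i \<kappa> * (\<kappa> $ i)\<^sup>2) - 1"
    using bounds(2) unfolding mult_1_left by (rule order_trans)
  show "(1 / (F \<kappa>)\<^sup>2) * (\<Sum>i\<in>UNIV. partial_deriv F i \<kappa> * (\<kappa> $ i)\<^sup>2) - 1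
      \<le> 6 * real CARD('n) * ((\<Sum>i\<in>UNIV. partial_deriv F i \<kappa>) - 1)"
    by (rule bounds(3))
qed

end
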